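(* Let $d\ge2$. For every pair of bounded star bodies $A_1,A_2\in\mathcal{S}_{rc}^d$, $$\delta(A_1,A_2)=\sup_{x\in\mathbb{R}^d}|d_r(x,A_1)-d_r(x,A_2)|=\max\{e_r(A_1,A_2),e_r(A_2,A_1)\}.$$
   Context: $B_2^d$ and $\mathbb{S}^{d-1}$ are the closed Euclidean unit ball and the unit sphere of $\mathbb{R}^d$. A star set is a non-empty $A\subseteq\mathbb{R}^d$ with $ta\in A$ for all $a\in A$, $0\le t\le 1$. Its radial function is $\rho_A:\mathbb{S}^{d-1}\to[0,\infty]$, $\rho_A(\theta)=\sup\{\lambda\ge 0:\lambda\theta\in A\}$. A star body is a star set $A$ that is radially closed: $\rho_A(\theta)\theta\in A$ whenever $\rho_A(\theta)<\infty$; it need not be closed. $\mathcal{S}_{rc}^d$ is the family of all star bodies in $\mathbb{R}^d$. The radial sum $A_1\tilde{+}A_2$ is the star body with radial function $\rho_{A_1}+\rho_{A_2}$. The radial distance from $x\in\mathbb{R}^d$ to $A\in\mathcal{S}_{rc}^d$ is $d_r(x,A)=\inf\{\alpha>0: x\in A\tilde{+}\alpha B_2^d\}$. The radial excess of $A_1$ over $A_2$ is $e_r(A_1,A_2)=\sup\{d_r(a,A_2):a\in A_1\}$. The radial metric between bounded star bodies is $\delta(A_1,A_2)=\sup_{\theta\in\mathbb{S}^{d-1}}|\rho_{A_1}(\theta)-\rho_{A_2}(\theta)|=\inf\{\alpha>0: A_1\subseteq A_2\tilde{+}\alpha B_2^d\text{ and }A_2\subseteq A_1\tilde{+}\alpha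 B_2^d\}$. *)

theory Defs
  imports "HOL-Analysis.Analysis"
begin

definition star_set :: "'a::euclidean_space set \<Rightarrow> bool" where
  "star_set A \<longleftrightarrow> A \<noteq> {} \<and> (\<forall>a\<in>A. \<forall>t::real. 0 \<le> t \<and> t \<le> 1 \<longrightarrow> t *\<^sub>R a \<in> A)"

text \<open>Suprema and infima are taken in \<^typ>\<open>ereal\<close>, so that the value \<open>\<infinity>\<close> is available and
  no junk value of \<^const>\<open>Sup\<close> on \<^typ>\<open>real\<close> can enter. The radial function is meaningful only
  for directions on the unit sphere.\<close>

definition radial_function :: "'a::euclidean_space set \<Rightarrow> 'a \<Rightarrow> ereal" where
  "radial_function A \<theta> = (SUP t\<in>{t::real. 0 \<le> t \<and> t *\<^sub>R \<theta> \<in> A}. ereal t)"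

definition radially_closed :: "'a::euclidean_space set \<Rightarrow> bool" where
  "radially_closed A \<longleftrightarrow>
     (\<forall>\<theta>\<in>sphere 0 1. radial_function A \<theta> < \<infinity> \<longrightarrow>
        real_of_ereal (radial_function A \<theta>) *\<^sub>R \<theta> \<in> A)"

definition star_body :: "'a::euclidean_space set \<Rightarrow> bool" where
  "star_body A \<longleftrightarrow> star_set A \<and> radially_closed A"

definition radial_sum :: "'a::euclidean_space set \<Rightarrow> 'a set \<Rightarrow> 'a set" where
  "radial_sum A B = (THE C. star_body C \<and>
     (\<forall>\<theta>\<in>sphere 0 1. radial_function C \<theta> = radial_function A \<theta> + radial_function B \<theta>))"

definition radial_dist :: "'a::euclidean_space \<Rightarrow> 'a set \<Rightarrow> ereal" where
  "radial_dist x A =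
     (INF \<alpha>\<in>{\<alpha>::real. 0 < \<alpha> \<and> x \<in> radial_sum A ((\<lambda>y. \<alpha> *\<^sub>R y) ` cball 0 1)}. ereal \<alpha>)"

definition radial_excess :: "'a::euclidean_space set \<Rightarrow> 'a set \<Rightarrow> ereal" where
  "radial_excess A B = (SUP a\<in>A. radial_dist a B)"

text \<open>Meant for bounded star bodies only, whose radial functions are finite; in \<^typ>\<open>ereal\<close> the
  difference \<open>\<infinity> - \<infinity>\<close> is \<open>\<infinity>\<close>.\<close>

definition radial_metric :: "'a::euclidean_space set \<Rightarrow> 'a set \<Rightarrow> ereal" where
  "radial_metric A B = (SUP \<theta>\<in>sphere 0 1. \<bar>radial_function A \<theta> - radial_function B \<theta>\<bar>)"

text \<open>The definite description in \<^const>\<open>radial_sum\<close> is proper: for star bodies there is exactly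
  one star body whose radial function is the sum.\<close>

lemma star_body_zero: "star_body A \<Longrightarrow> 0 \<in> A"
  unfolding star_body_def star_set_def by (metis ex_in_conv order_refl scaleR_zero_left zero_le_one)

lemma star_body_mem_iff:
  assumes A: "star_body A" and \<theta>: "\<theta> \<in> sphere 0 1" and t: "0 \<le> t"
  shows "t *\<^sub>R \<theta> \<in> A \<longleftrightarrow> ereal t \<le> radial_function A \<theta>"
proof
  assume "t *\<^sub>R \<theta> \<in> A"
  then show "ereal t \<le> radial_function A \<theta>"
    unfolding radial_function_def using t by (intro SUP_upper) auto
next
  assume le: "ereal t \<le> radial_function A \<theta>"
  have down: "t *\<^sub>R \<theta> \<in> A" if "s *\<^sub>R \<theta> \<in> A" "t \<le> s" for s
  proof (cases "s = 0")
    case True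
    then show ?thesis using that t by simp
  next
    case False
    then have "s > 0" using that t by simp
    then have "(t / s) *\<^sub>R (s *\<^sub>R \<theta>) \<in> A"
      using A that t unfolding star_body_def star_set_def by (metis divide_le_eq_1_pos divide_nonneg_pos)
    then show ?thesis using \<open>s > 0\<close> by simp
  qed
  show "t *\<^sub>R \<theta> \<in> A"
  proof (cases "radial_function A \<theta> = \<infinity>")
    case True
    then have "ereal t < radial_function A \<theta>" by simp
    then obtain s where "s *\<^sub>R \<theta> \<in> A" "t < s"
      unfolding radial_function_def less_SUP_iff by auto
    then show ?thesis using down by simp
  next
    case False
    then obtain r where r: "radial_function A \<theta> = ereal r"
      using le by (cases "radial_function A \<theta>") auto
    then have "r *\<^sub>R \<theta> \<in> A"
      using A \<theta> unfolding star_body_def radially_closed_def by force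
    then show ?thesis using down le r by simp
  qed
qed

lemma star_body_eqI:
  assumes A: "star_body A" and B: "star_body B"
    and eq: "\<And>\<theta>. \<theta> \<in> sphere 0 1 \<Longrightarrow> radial_function A \<theta> = radial_function B \<theta>"
  shows "A = B"
proof (rule set_eqI)
  fix x
  show "x \<in> A \<longleftrightarrow> x \<in> B"
  proof (cases "x = 0")
    case True
    then show ?thesis using star_body_zero A B by blast
  next
    case False
    then have s: "sgn x \<in> sphere 0 1" by (simp add: norm_sgn)
    have x: "x = norm x *\<^sub>R sgn x" using False by (simp add: sgn_div_norm)
    show ?thesis
      using star_body_mem_iff[OF A s norm_ge_zero[of x]] star_body_mem_iff[OF B s norm_ge_zero[of x]]
        eq[OF s] x by simp
  qed
qed

lemma star_body_exists:
  fixes f :: "'a::euclidean_space \<Rightarrow> ereal"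
  assumes f: "\<And>\<theta>. \<theta> \<in> sphere 0 1 \<Longrightarrow> 0 \<le> f \<theta>"
  shows "\<exists>C. star_body C \<and> (\<forall>\<theta>\<in>sphere 0 1. radial_function C \<theta> = f \<theta>)"
proof -
  define C where "C = {x. x = 0 \<or> ereal (norm x) \<le> f (sgn x)}"
  have mem: "t *\<^sub>R \<theta> \<in> C \<longleftrightarrow> ereal t \<le> f \<theta>" if "\<theta> \<in> sphere 0 1" "0 \<le> t" for t \<theta>
  proof (cases "t = 0")
    case True
    then show ?thesis using f[OF that(1)] by (simp add: C_def zero_ereal_def[symmetric])
  next
    case False
    have "norm \<theta> = 1" using that by simp
    then have "sgn \<theta> = \<theta>" "\<theta> \<noteq> 0" by (auto simp: sgn_div_norm)
    then show ?thesis using False that by (simp add: C_def sgn_scaleR)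
  qed
  have rad: "radial_function C \<theta> = f \<theta>" if th: "\<theta> \<in> sphere 0 1" for \<theta>
  proof -
    have S: "{t::real. 0 \<le> t \<and> t *\<^sub>R \<theta> \<in> C} = {t. 0 \<le> t \<and> ereal t \<le> f \<theta>}"
      using mem[OF th] by auto
    show ?thesis
      unfolding radial_function_def S
    proof (rule antisym)
      show "(SUP t\<in>{t. 0 \<le> t \<and> ereal t \<le> f \<theta>}. ereal t) \<le> f \<theta>"
        by (rule SUP_least) auto
      show "f \<theta> \<le> (SUP t\<in>{t. 0 \<le> t \<and> ereal t \<le> f \<theta>}. ereal t)"
      proof (cases "f \<theta>")
        case (real r)
        then show ?thesis using f[OF th] by (intro SUP_upper2[of r]) auto
      next
        case PInf
        have "(SUP t\<in>{t::real. 0 \<le> t \<and> ereal t \<le> f \<theta>}. ereal t) = \<infinity>"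
        proof (rule SUP_PInfty)
          fix n :: nat
          show "\<exists>t\<in>{t::real. 0 \<le> t \<and> ereal t \<le> f \<theta>}. ereal (real n) \<le> ereal t"
            using PInf by (intro bexI[of _ "real n"]) auto
        qed
        then show ?thesis by simp
      next
        case MInf
        then show ?thesis by simp
      qed
    qed
  qed
  have "star_set C"
    unfolding star_set_def
  proof (intro conjI ballI allI impI)
    show "C \<noteq> {}" by (auto simp: C_def)
    fix a t assume a: "a \<in> C" and t: "0 \<le> (t::real) \<and> t \<le> 1"
    show "t *\<^sub>R a \<in> C"
    proof (cases "t = 0 \<or> a = 0")
      case True
      then show ?thesis by (auto simp: C_def)
    next
      case False
      then have "sgn (t *\<^sub>R a) = sgn a" using t by (simp add: sgn_scaleR)
      moreover have "norm (t *\<^sub>R a) \<le> norm a" using t by (simp add: mult_left_le_one_le)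
      ultimately show ?thesis
        using a False by (auto simp: C_def simp del: norm_scaleR intro: order_trans[of _ "ereal (norm a)"])
    qed
  qed
  moreover have "radially_closed C"
    unfolding radially_closed_def
  proof (intro ballI impI)
    fix \<theta> :: 'a assume th: "\<theta> \<in> sphere 0 1" and fin: "radial_function C \<theta> < \<infinity>"
    then obtain r where "f \<theta> = ereal r" "0 \<le> r"
      using rad[OF th] f[OF th] by (cases "f \<theta>") auto
    then show "real_of_ereal (radial_function C \<theta>) *\<^sub>R \<theta> \<in> C"
      using rad[OF th] mem[OF th] by simp
  qed
  ultimately show ?thesis using rad unfolding star_body_def by blast
qed

lemma radial_sum_ex1:
  assumes "star_body A" "star_body B"
  shows "\<exists>!C. star_body C \<and>
    (\<forall>\<theta>\<in>sphere 0 1. radial_function C \<theta> = radial_function A \<theta> + radial_function B \<theta>)"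
proof -
  have nn: "0 \<le> radial_function D \<theta>" if "star_body D" for D and \<theta> :: 'a
    unfolding radial_function_def
    by (rule SUP_upper2[of 0]) (use star_body_zero[OF that] in auto)
  have "\<exists>C. star_body C \<and>
    (\<forall>\<theta>\<in>sphere 0 1. radial_function C \<theta> = radial_function A \<theta> + radial_function B \<theta>)"
    by (rule star_body_exists) (simp add: nn assms)
  moreover have "C = D" if "star_body C" "star_body D"
    "\<forall>\<theta>\<in>sphere 0 1. radial_function C \<theta> = radial_function A \<theta> + radial_function B \<theta>"
    "\<forall>\<theta>\<in>sphere 0 1. radial_function D \<theta> = radial_function A \<theta> + radial_function B \<theta>" for C D
    by (rule star_body_eqI[OF that(1,2)]) (metis that(3,4))
  ultimately show ?thesis by blast
qed

end

(* Along the ray through a unit vector \<theta> the radial distance is d_r(t \<theta>, A) = max(0, t - \<rho>_A(\<theta>)).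
   This is 1-Lipschitz in \<rho>_A(\<theta>), and for t = max(\<rho>_{A1}(\<theta>), \<rho>_{A2}(\<theta>)) the difference of the
   two distances is exactly \<rho>_{A1}(\<theta>) - \<rho>_{A2}(\<theta>) up to sign, at a point of A1 or of A2. *)
theory Submission
  imports Defs
begin

lemma polar_decomposition:
  fixes x :: "'a::euclidean_space"
  obtains t \<theta> where "\<theta> \<in> sphere 0 1" "0 \<le> t" "x = t *\<^sub>R \<theta>"
proof (cases "x = 0")
  case True
  obtain b :: 'a where "b \<in> Basis" using nonempty_Basis by blast
  then show ?thesis using that[of b 0] True by simp
next
  case False
  then show ?thesis using that[of "sgn x" "norm x"] by (simp add: norm_sgn sgn_div_norm)
qed

text \<open>A norm bound on the set bounds each radial supremum, and \<open>0\<close> in the set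
  bounds it below. Finite values let all later estimates run in the reals.\<close>

lemma radial_function_bounded:
  assumes A: "star_body A" "bounded A" and \<theta>: "\<theta> \<in> sphere 0 1"
  obtains r where "0 \<le> r" "radial_function A \<theta> = ereal r"
proof -
  obtain K where K: "\<And>x. x \<in> A \<Longrightarrow> norm x \<le> K"
    using A(2) unfolding bounded_iff by blast
  have "radial_function A \<theta> \<le> ereal K"
    unfolding radial_function_def by (rule SUP_least) (use K \<theta> in force)
  moreover have "0 \<le> radial_function A \<theta>"
    using star_body_mem_iff[OF A(1) \<theta>, of 0] star_body_zero[OF A(1)]
    by (simp add: zero_ereal_def)
  ultimately show ?thesis
    using that by (cases "radial_function A \<theta>") auto
qed

lemma radial_function_cball:
  assumes "0 \<le> \<alpha>" "\<theta> \<in> sphere 0 1"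
  shows "radial_function (cball 0 \<alpha>) \<theta> = ereal \<alpha>"
  unfolding radial_function_def
  by (rule antisym) (use assms in \<open>auto intro!: SUP_least SUP_upper\<close>)

text \<open>Makes dilated balls admissible summands, so that the description behind
  \<open>radial_sum\<close> is proper in \<open>radial_dist\<close>.\<close>

lemma star_body_cball:
  assumes "0 \<le> \<alpha>"
  shows "star_body (cball (0::'a::euclidean_space) \<alpha>)"
proof -
  have "t * norm a \<le> \<alpha>" if "norm a \<le> \<alpha>" "0 \<le> t" "t \<le> 1" for t and a :: 'a
    using mult_left_le_one_le[of "norm a" t] that by simp
  then show ?thesis
    using assms
    by (auto simp: star_body_def star_set_def radially_closed_def radial_function_cball
        simp del: mem_sphere)
qed

text \<open>The definite description is eliminated here once and for all: by
  \<open>radial_sum_ex1\<close> the sum is a star body with the added radial function, and that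
  function decides membership on each ray.\<close>

lemma mem_radial_sum_iff:
  assumes "star_body A" "star_body B" "\<theta> \<in> sphere 0 1" "0 \<le> t"
  shows "t *\<^sub>R \<theta> \<in> radial_sum A B \<longleftrightarrow> ereal t \<le> radial_function A \<theta> + radial_function B \<theta>"
  using theI'[OF radial_sum_ex1[OF assms(1,2)], folded radial_sum_def] assms(3,4)
  by (simp add: star_body_mem_iff)

text \<open>Adding the ball of radius \<alpha> moves the endpoint on the ray from \<open>r\<close>
  to \<open>r + \<alpha>\<close>, so the admissible \<alpha> are the positive ones with
  \<open>t - r \<le> \<alpha>\<close>.\<close>

lemma radial_dist_ray:
  assumes A: "star_body A" and \<theta>: "\<theta> \<in> sphere 0 1" and t: "0 \<le> t"
    and r: "radial_function A \<theta> = ereal r"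
  shows "radial_dist (t *\<^sub>R \<theta>) A = ereal (max 0 (t - r))"
proof -
  have "t *\<^sub>R \<theta> \<in> radial_sum A ((\<lambda>y. \<alpha> *\<^sub>R y) ` cball 0 1) \<longleftrightarrow> t - r \<le> \<alpha>" if "0 < \<alpha>" for \<alpha>
    using that mem_radial_sum_iff[OF A star_body_cball \<theta> t, of \<alpha>]
    by (auto simp: cball_scale radial_function_cball[OF _ \<theta>] r)
  then have S: "{\<alpha>. 0 < \<alpha> \<and> t *\<^sub>R \<theta> \<in> radial_sum A ((\<lambda>y. \<alpha> *\<^sub>R y) ` cball 0 1)}
      = {\<alpha>. 0 < \<alpha> \<and> t - r \<le> \<alpha>}"
    by blast
  show ?thesis
    unfolding radial_dist_def S
  proof (rule antisym)
    show "(INF \<alpha>\<in>{\<alpha>. 0 < \<alpha> \<and> t - r \<le> \<alpha>}. ereal \<alpha>) \<le> ereal (max 0 (t - r))"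
    \<comment> \<open>Since \<alpha> must be positive, the infimum is not attained when
      \<open>t \<le> r\<close>; the slack \<open>e\<close> makes the witness positive.\<close>
    proof (rule ereal_le_epsilon2)
      fix e :: real assume "0 < e"
      then show "(INF \<alpha>\<in>{\<alpha>. 0 < \<alpha> \<and> t - r \<le> \<alpha>}. ereal \<alpha>) \<le> ereal (max 0 (t - r)) + ereal e"
        by (intro INF_lower2[of "max 0 (t - r) + e"]) (auto simp del: ereal_max)
    qed
  qed (auto intro!: INF_greatest)
qed

text \<open>A point of \<open>A\<close> has radial distance 0 from \<open>A\<close>, so its distance
  from \<open>B\<close> is itself one of the differences on the right.\<close>

lemma radial_excess_le_SUP:
  fixes A B :: "'a::euclidean_space set"
  assumes A: "star_body A" "bounded A" and B: "star_body B" "bounded B"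
  shows "radial_excess A B \<le> (SUP x\<in>UNIV. \<bar>radial_dist x A - radial_dist x B\<bar>)"
  unfolding radial_excess_def
proof (rule SUP_mono)
  fix x assume x: "x \<in> A"
  obtain t \<theta> where \<theta>: "\<theta> \<in> sphere 0 1" "0 \<le> t" "x = t *\<^sub>R \<theta>"
    by (rule polar_decomposition)
  obtain a where a: "radial_function A \<theta> = ereal a"
    using radial_function_bounded[OF A \<theta>(1)] .
  obtain b where b: "radial_function B \<theta> = ereal b"
    using radial_function_bounded[OF B \<theta>(1)] .
  have "t \<le> a" using star_body_mem_iff[OF A(1) \<theta>(1,2)] x \<theta>(3) a by simp
  then show "\<exists>y\<in>UNIV. radial_dist x B \<le> \<bar>radial_dist y A - radial_dist y B\<bar>"
    using radial_dist_ray[OF A(1) \<theta>(1,2) a] radial_dist_ray[OF B(1) \<theta>(1,2) b] \<theta>(3)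
    by (intro bexI[of _ x]) (auto simp del: ereal_max)
qed

text \<open>The endpoint \<open>a *\<^sub>R \<theta>\<close> lies in \<open>A\<close> because
  \<open>A\<close> is radially closed, and its distance from \<open>B\<close> is
  \<open>max 0 (a - b)\<close>.\<close>

lemma diff_radial_function_le_excess:
  assumes A: "star_body A" "bounded A" and B: "star_body B" and \<theta>: "\<theta> \<in> sphere 0 1"
    and a: "radial_function A \<theta> = ereal a" and b: "radial_function B \<theta> = ereal b"
  shows "ereal (a - b) \<le> radial_excess A B"
proof -
  have a0: "0 \<le> a" using radial_function_bounded[OF A \<theta>] a by auto
  have "ereal (a - b) \<le> radial_dist (a *\<^sub>R \<theta>) B"
    using radial_dist_ray[OF B \<theta> a0 b] by simp
  also have "\<dots> \<le> radial_excess A B"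
    unfolding radial_excess_def
    by (rule SUP_upper) (simp add: star_body_mem_iff[OF A(1) \<theta> a0] a)
  finally show ?thesis .
qed

lemma radial_metric_le_excess:
  fixes A B :: "'a::euclidean_space set"
  assumes A: "star_body A" "bounded A" and B: "star_body B" "bounded B"
  shows "radial_metric A B \<le> max (radial_excess A B) (radial_excess B A)"
  unfolding radial_metric_def
proof (rule SUP_least)
  fix \<theta> :: 'a assume \<theta>: "\<theta> \<in> sphere 0 1"
  obtain a where a: "radial_function A \<theta> = ereal a"
    using radial_function_bounded[OF A \<theta>] .
  obtain b where b: "radial_function B \<theta> = ereal b"
    using radial_function_bounded[OF B \<theta>] .
  \<comment> \<open>The sign of \<open>a - b\<close> selects which of the two excesses gives the
    bound.\<close>
  have "ereal \<bar>a - b\<bar> \<le> max (radial_excess A B) (radial_excess B A)"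
    using diff_radial_function_le_excess[OF A B(1) \<theta> a b]
      diff_radial_function_le_excess[OF B A(1) \<theta> b a]
    by (cases "b \<le> a") (auto simp: le_max_iff_disj abs_if)
  then show "\<bar>radial_function A \<theta> - radial_function B \<theta>\<bar>
      \<le> max (radial_excess A B) (radial_excess B A)"
    by (simp add: a b)
qed

lemma SUP_radial_dist_le_radial_metric:
  fixes A B :: "'a::euclidean_space set"
  assumes A: "star_body A" "bounded A" and B: "star_body B" "bounded B"
  shows "(SUP x\<in>UNIV. \<bar>radial_dist x A - radial_dist x B\<bar>) \<le> radial_metric A B"
  unfolding radial_metric_def
proof (rule SUP_mono)
  fix x :: 'a
  obtain t \<theta> where \<theta>: "\<theta> \<in> sphere 0 1" "0 \<le> t" "x = t *\<^sub>R \<theta>"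
    by (rule polar_decomposition)
  obtain a where a: "radial_function A \<theta> = ereal a"
    using radial_function_bounded[OF A \<theta>(1)] .
  obtain b where b: "radial_function B \<theta> = ereal b"
    using radial_function_bounded[OF B \<theta>(1)] .
  show "\<exists>\<theta>\<in>sphere 0 1. \<bar>radial_dist x A - radial_dist x B\<bar>
      \<le> \<bar>radial_function A \<theta> - radial_function B \<theta>\<bar>"
    \<comment> \<open>The direction of \<open>x\<close> is the witness. With \<open>max\<close> kept
      inside \<open>ereal\<close>, the Lipschitz bound is real arithmetic.\<close>
    using radial_dist_ray[OF A(1) \<theta>(1,2) a] radial_dist_ray[OF B(1) \<theta>(1,2) b] \<theta>(1,3) a b
    by (intro bexI[of _ \<theta>]) (auto simp del: ereal_max)
qed

theorem proposition2p3:
  fixes A1 A2 :: "(real ^ 'd) set"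
  assumes "2 \<le> CARD('d)"
    and "star_body A1" and "bounded A1"
    and "star_body A2" and "bounded A2"
  shows "radial_metric A1 A2 = (SUP x\<in>UNIV. \<bar>radial_dist x A1 - radial_dist x A2\<bar>)
    \<and> (SUP x\<in>UNIV. \<bar>radial_dist x A1 - radial_dist x A2\<bar>)
        = max (radial_excess A1 A2) (radial_excess A2 A1)"
proof -
  \<comment> \<open>Symmetry of \<open>?S\<close> in the two bodies lets it bound both
    excesses.\<close>
  have abs_diff_commute: "\<bar>x - y\<bar> = \<bar>y - x\<bar>" for x y :: ereal
    by (cases x; cases y) auto
  let ?S = "SUP x\<in>UNIV. \<bar>radial_dist x A1 - radial_dist x A2\<bar>"
  have "?S = (SUP x\<in>UNIV. \<bar>radial_dist x A2 - radial_dist x A1\<bar>)"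
    by (simp add: abs_diff_commute)
  then have "max (radial_excess A1 A2) (radial_excess A2 A1) \<le> ?S"
    using radial_excess_le_SUP[OF assms(2-5)] radial_excess_le_SUP[OF assms(4,5,2,3)] by simp
  \<comment> \<open>The inequalities close a cycle: larger excess \<le> \<open>?S\<close> \<le>
    metric \<le> larger excess.\<close>
  then show ?thesis
    using radial_metric_le_excess[OF assms(2-5)] SUP_radial_dist_le_radial_metric[OF assms(2-5)]
    by (intro conjI antisym) (blast intro: order_trans)+
qed

end
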